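(* Let $k$ be a perfect field of characteristic $2$ and let $l\ge1$. Every element of the orthogonal group $O(2l+1,k)$ can be written as a product of elementary matrices.
   Context: Rows and columns are indexed in the order $0,1,\ldots,l,-1,\ldots,-l$; $I$ is the identity matrix and $e_{a,b}$ the matrix unit with $1$ in place $(a,b)$. $O(2l+1,k)$ is the group of $g\in GL(2l+1,k)$ with $Q(gx)=Q(x)$ for all $x\in k^{2l+1}$, where $Q(x)=x_0^2+x_1x_{-1}+\cdots+x_lx_{-l}$. The elementary matrices of $O(2l+1,k)$ in characteristic $2$ are, for $t\in k$ and $1\le i,j\le l$: $x_{i,j}(t)=I+t(e_{i,j}-e_{-j,-i})$ for $i\neq j$; $x_{i,-j}(t)=I+t(e_{i,-j}-e_{j,-i})$ for $i<j$; $x_{-i,j}(t)=I+t(e_{-i,j}-e_{-j,i})$ for $i<j$; $x_{i,0}(t)=I+te_{0,-i}+t^2e_{i,-i}$; $x_{0,i}(t)=I+te_{0,i}+t^2e_{-i,i}$. *)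

theory Defs
  imports "Jordan_Normal_Form.Matrix"
begin

definition perfect_field :: "'a::field itself \<Rightarrow> bool" where
  "perfect_field _ \<longleftrightarrow> CHAR('a) = 0 \<or> surj (\<lambda>x::'a. x ^ CHAR('a))"

(* Rows and columns are labelled 0, 1, ..., l, -1, ..., -l, in this order;
   pos l a is the position, counted from 0, of the label a. *)
definition pos :: "nat \<Rightarrow> int \<Rightarrow> nat" where
  "pos l a = (if 0 \<le> a then nat a else l + nat (- a))"

definition unit_matrix :: "nat \<Rightarrow> int \<Rightarrow> int \<Rightarrow> 'a::field mat" where
  "unit_matrix l a b =
     mat (2 * l + 1) (2 * l + 1) (\<lambda>(r, c). if r = pos l a \<and> c = pos l b then 1 else 0)"

definition quadratic_form :: "nat \<Rightarrow> 'a::field vec \<Rightarrow> 'a" where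
  "quadratic_form l x =
     (x $ pos l 0)\<^sup>2 + (\<Sum>i = 1..int l. x $ pos l i * x $ pos l (- i))"

definition orthogonal_group :: "nat \<Rightarrow> 'a::field mat set" where
  "orthogonal_group l =
     {g \<in> carrier_mat (2 * l + 1) (2 * l + 1). invertible_mat g \<and>
        (\<forall>x \<in> carrier_vec (2 * l + 1). quadratic_form l (g *\<^sub>v x) = quadratic_form l x)}"

(* These are the elementary matrices for characteristic 2 only: in other characteristics
   the last two families do not preserve the quadratic form. *)
inductive_set elementary_matrices :: "nat \<Rightarrow> 'a::field mat set" for l :: nat where
  x_pos_pos: "i \<in> {1..int l} \<Longrightarrow> j \<in> {1..int l} \<Longrightarrow> i \<noteq> j \<Longrightarrow>
     1\<^sub>m (2 * l + 1) + t \<cdot>\<^sub>m (unit_matrix l i j - unit_matrix l (- j) (- i))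
       \<in> elementary_matrices l"
| x_pos_neg: "i \<in> {1..int l} \<Longrightarrow> j \<in> {1..int l} \<Longrightarrow> i < j \<Longrightarrow>
     1\<^sub>m (2 * l + 1) + t \<cdot>\<^sub>m (unit_matrix l i (- j) - unit_matrix l j (- i))
       \<in> elementary_matrices l"
| x_neg_pos: "i \<in> {1..int l} \<Longrightarrow> j \<in> {1..int l} \<Longrightarrow> i < j \<Longrightarrow>
     1\<^sub>m (2 * l + 1) + t \<cdot>\<^sub>m (unit_matrix l (- i) j - unit_matrix l (- j) i)
       \<in> elementary_matrices l"
| x_pos_zero: "i \<in> {1..int l} \<Longrightarrow>
     1\<^sub>m (2 * l + 1) + t \<cdot>\<^sub>m unit_matrix l 0 (- i) + t\<^sup>2 \<cdot>\<^sub>m unit_matrix l i (- i)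
       \<in> elementary_matrices l"
| x_zero_pos: "i \<in> {1..int l} \<Longrightarrow>
     1\<^sub>m (2 * l + 1) + t \<cdot>\<^sub>m unit_matrix l 0 i + t\<^sup>2 \<cdot>\<^sub>m unit_matrix l (- i) i
       \<in> elementary_matrices l"

definition mat_product :: "nat \<Rightarrow> 'a::field mat list \<Rightarrow> 'a mat" where
  "mat_product n gs = foldr (*) gs (1\<^sub>m n)"

end

theory Submission
  imports Defs
begin

text \<open>
  Write \<open>e\<^sub>a\<close> for the basis vector labelled \<open>a\<close>. In characteristic 2 the elementary matrices are
  involutions, so it suffices to reduce an isometry \<open>g\<close> to the identity by multiplying elementary
  matrices from the left. Suppose that \<open>g\<close> fixes \<open>e\<^sub>d\<close> for \<open>0 < \<bar>d\<bar> \<le> m\<close>, and let \<open>c = m + 1\<close>. Since \<open>g\<close>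
  preserves the polar form, \<open>g e\<^sub>c\<close> has zero coordinates at these \<open>d\<close> and lies outside the radical, so
  some other coordinate with nonzero label does not vanish; square roots in \<open>k\<close> allow us to make its
  coordinate at \<open>c\<close> equal to 1. Then all other coordinates are cleared, the one at \<open>-c\<close> because the
  vector is singular, and we may assume \<open>g e\<^sub>c = e\<^sub>c\<close>. Now \<open>g e\<^sub>-\<^sub>c\<close> has coordinate 1 at \<open>-c\<close> and is
  cleared in the same way by elementary matrices that fix \<open>e\<^sub>c\<close>. An isometry that fixes all \<open>e\<^sub>d\<close> with
  \<open>d \<noteq> 0\<close> maps \<open>e\<^sub>0\<close> to a multiple \<open>s e\<^sub>0\<close> with \<open>s\<^sup>2 = 1\<close>, hence \<open>s = 1\<close>.
\<close>

(* The simplifier would otherwise turn the dimension 2 * l + 1 into Suc (2 * l). *)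
declare One_nat_def [simp del]

section \<open>Labels, positions and coordinates\<close>

abbreviation labels :: "nat \<Rightarrow> int set" where
  "labels l \<equiv> {- int l..int l}"

abbreviation basis_vec :: "nat \<Rightarrow> int \<Rightarrow> 'a::field vec" where
  "basis_vec l a \<equiv> unit_vec (2 * l + 1) (pos l a)"

lemma pos_less: "a \<in> labels l \<Longrightarrow> pos l a < 2 * l + 1"
  by (auto simp: pos_def)

lemma pos_eq_iff: "a \<in> labels l \<Longrightarrow> b \<in> labels l \<Longrightarrow> pos l a = pos l b \<longleftrightarrow> a = b"
  by (auto simp: pos_def split: if_splits)

lemma ex_label:
  assumes "r < 2 * l + 1" obtains a where "a \<in> labels l" "r = pos l a"
proof (cases "r \<le> l")
  case True
  then show ?thesis by (intro that[of "int r"]) (auto simp: pos_def)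
next
  case False
  then show ?thesis using assms by (intro that[of "int l - int r"]) (auto simp: pos_def)
qed

lemma eq_vec_labelsI:
  assumes "x \<in> carrier_vec (2 * l + 1)" "y \<in> carrier_vec (2 * l + 1)"
    and "\<And>a. a \<in> labels l \<Longrightarrow> x $ pos l a = y $ pos l a"
  shows "x = y"
  using assms by (intro eq_vecI) (auto elim!: ex_label)

lemma basis_vec_index:
  "a \<in> labels l \<Longrightarrow> b \<in> labels l \<Longrightarrow> (basis_vec l b :: 'a::field vec) $ pos l a = (if a = b then 1 else 0)"
  using pos_less[of a l] pos_less[of b l] pos_eq_iff[of a l b] by simp

lemma mult_unit_vec:
  fixes A :: "'a::field mat"
  assumes "A \<in> carrier_mat n n" "i < n"
  shows "A *\<^sub>v unit_vec n i = col A i"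
  using assms by (intro eq_vecI) auto

lemma eq_mat_unit_vecI:
  fixes A B :: "'a::field mat"
  assumes A: "A \<in> carrier_mat n n" and B: "B \<in> carrier_mat n n"
    and eq: "\<And>i. i < n \<Longrightarrow> A *\<^sub>v unit_vec n i = B *\<^sub>v unit_vec n i"
  shows "A = B"
proof (rule mat_col_eqI)
  fix i assume "i < dim_col B"
  then have "i < n" using B by auto
  then show "col A i = col B i"
    using eq mult_unit_vec[OF A] mult_unit_vec[OF B] by metis
qed (use A B in auto)

lemma unit_matrix_carrier [simp]: "unit_matrix l a b \<in> carrier_mat (2 * l + 1) (2 * l + 1)"
  by (simp add: unit_matrix_def)

lemma unit_matrix_dim [simp]:
  "dim_row (unit_matrix l a b) = 2 * l + 1" "dim_col (unit_matrix l a b) = 2 * l + 1"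
  by (simp_all add: unit_matrix_def)

lemma unit_matrix_mult_index:
  fixes x :: "'a::field vec"
  assumes "a \<in> labels l" "b \<in> labels l" "c \<in> labels l" "x \<in> carrier_vec (2 * l + 1)"
  shows "(unit_matrix l a b *\<^sub>v x) $ pos l c = (if c = a then x $ pos l b else 0)"
proof -
  have "(unit_matrix l a b *\<^sub>v x) $ pos l c
      = (\<Sum>k\<in>{0..<2 * l + 1}. (if c = a \<and> k = pos l b then 1 else 0) * x $ k)"
    using assms pos_less[of c l] pos_eq_iff[of c l a]
    by (auto simp: unit_matrix_def scalar_prod_def intro!: sum.cong)
  also have "\<dots> = (\<Sum>k\<in>{0..<2 * l + 1}. if k = pos l b then (if c = a then x $ k else 0) else 0)"
    by (intro sum.cong) auto
  also have "\<dots> = (if c = a then x $ pos l b else 0)"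
    using pos_less[of b l] assms(2) by (subst sum.delta) auto
  finally show ?thesis .
qed

section \<open>Elementary matrices in characteristic 2\<close>

(* With arbitrary signs of the labels, root_mat covers the families x_{i,j}, x_{i,-j}, x_{-i,j},
   and root0_mat covers x_{i,0} and x_{0,i}. *)
definition root_mat :: "nat \<Rightarrow> int \<Rightarrow> int \<Rightarrow> 'a::field \<Rightarrow> 'a mat" where
  "root_mat l a b t = 1\<^sub>m (2 * l + 1) + t \<cdot>\<^sub>m (unit_matrix l a b + unit_matrix l (- b) (- a))"

definition root0_mat :: "nat \<Rightarrow> int \<Rightarrow> 'a::field \<Rightarrow> 'a mat" where
  "root0_mat l a t =
     1\<^sub>m (2 * l + 1) + t \<cdot>\<^sub>m unit_matrix l 0 (- a) + t\<^sup>2 \<cdot>\<^sub>m unit_matrix l a (- a)"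

lemma root_mat_carrier [simp]: "root_mat l a b t \<in> carrier_mat (2 * l + 1) (2 * l + 1)"
  by (simp add: root_mat_def)

lemma root0_mat_carrier [simp]: "root0_mat l a t \<in> carrier_mat (2 * l + 1) (2 * l + 1)"
  by (simp add: root0_mat_def)

lemma smult_mat_mult_vec:
  fixes A :: "'a::field mat"
  assumes "A \<in> carrier_mat n n" "x \<in> carrier_vec n"
  shows "(t \<cdot>\<^sub>m A) *\<^sub>v x = t \<cdot>\<^sub>v (A *\<^sub>v x)"
  using assms by (intro eq_vecI) auto

lemma root_mat_mult_index:
  fixes x :: "'a::field vec"
  assumes "a \<in> labels l" "b \<in> labels l" "c \<in> labels l" "x \<in> carrier_vec (2 * l + 1)"
  shows "(root_mat l a b t *\<^sub>v x) $ pos l c = x $ pos l c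
    + t * ((if c = a then x $ pos l b else 0) + (if c = - b then x $ pos l (- a) else 0))"
proof -
  let ?n = "2 * l + 1"
  have u: "unit_matrix l a b *\<^sub>v x \<in> carrier_vec ?n" "unit_matrix l (- b) (- a) *\<^sub>v x \<in> carrier_vec ?n"
    using assms(4) by (auto intro!: mult_mat_vec_carrier[OF unit_matrix_carrier])
  have "root_mat l a b t *\<^sub>v x
      = x + t \<cdot>\<^sub>v (unit_matrix l a b *\<^sub>v x + unit_matrix l (- b) (- a) *\<^sub>v x)"
    using assms(4) unfolding root_mat_def
    by (simp add: add_mult_distrib_mat_vec[of _ ?n ?n] smult_mat_mult_vec[of _ ?n])
  then show ?thesis
    using assms u pos_less[of c l] unit_matrix_mult_index[of a l b c x]
      unit_matrix_mult_index[of "- b" l "- a" c x] by auto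
qed

lemma root0_mat_mult_index:
  fixes x :: "'a::field vec"
  assumes "a \<in> labels l" "c \<in> labels l" "x \<in> carrier_vec (2 * l + 1)"
  shows "(root0_mat l a t *\<^sub>v x) $ pos l c = x $ pos l c
    + (if c = 0 then t * x $ pos l (- a) else 0) + (if c = a then t\<^sup>2 * x $ pos l (- a) else 0)"
proof -
  let ?n = "2 * l + 1"
  have u: "unit_matrix l 0 (- a) *\<^sub>v x \<in> carrier_vec ?n" "unit_matrix l a (- a) *\<^sub>v x \<in> carrier_vec ?n"
    using assms(3) by (auto intro!: mult_mat_vec_carrier[OF unit_matrix_carrier])
  have "root0_mat l a t *\<^sub>v x
      = x + t \<cdot>\<^sub>v (unit_matrix l 0 (- a) *\<^sub>v x) + t\<^sup>2 \<cdot>\<^sub>v (unit_matrix l a (- a) *\<^sub>v x)"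
    using assms(3) unfolding root0_mat_def
    by (simp add: add_mult_distrib_mat_vec[of _ ?n ?n] smult_mat_mult_vec[of _ ?n])
  then show ?thesis
    using assms u pos_less[of c l] unit_matrix_mult_index[of 0 l "- a" c x]
      unit_matrix_mult_index[of a l "- a" c x] by auto
qed

lemma char2_double:
  assumes "CHAR('k::field) = 2" shows "(x::'k) + x = 0"
proof -
  have "of_nat CHAR('k) = (0::'k)" by (rule of_nat_CHAR)
  then have "(2::'k) = 0" using assms by simp
  then show ?thesis by (metis mult_2 mult_zero_left)
qed

lemma char2_diff:
  assumes "CHAR('k::field) = 2" shows "(x::'k) - y = x + y"
  using char2_double[OF assms, of y] by (simp add: diff_eq_eq add.assoc)

lemma char2_mat_diff:
  fixes A B :: "'k::field mat"
  assumes "CHAR('k) = 2" "A \<in> carrier_mat n m" "B \<in> carrier_mat n m"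
  shows "A - B = A + B"
  using assms by (intro eq_matI) (auto simp: char2_diff)

lemma perfect_char2_sqrt:
  fixes s :: "'k::field"
  assumes "perfect_field TYPE('k)" "CHAR('k) = 2"
  obtains t where "t\<^sup>2 = s"
proof -
  have "surj (\<lambda>x::'k. x\<^sup>2)"
    using assms by (simp add: perfect_field_def)
  then show ?thesis using that by (metis surjD)
qed

text \<open>Signs disappear in characteristic 2, so the five families merge into two whose labels
  may have any sign. Later arguments can then choose labels without distinguishing signs.\<close>

lemma elementary_matrices_char2:
  assumes char2: "CHAR('k::field) = 2"
  shows "(elementary_matrices l :: 'k mat set) =
     {root_mat l a b t |a b t. a \<in> labels l - {0} \<and> b \<in> labels l - {0} \<and> a \<noteq> b \<and> a \<noteq> - b}
     \<union> {root0_mat l a t |a t. a \<in> labels l - {0}}"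
proof -
  let ?R = "{root_mat l a b (t :: 'k) |a b t.
      a \<in> labels l - {0} \<and> b \<in> labels l - {0} \<and> a \<noteq> b \<and> a \<noteq> - b}"
  let ?Z = "{root0_mat l a (t :: 'k) |a t. a \<in> labels l - {0}}"
  note diff = char2_mat_diff[OF char2 unit_matrix_carrier unit_matrix_carrier]
  have comm: "unit_matrix l a b + unit_matrix l c d = unit_matrix l c d + (unit_matrix l a b :: 'k mat)"
    for a b c d by (rule comm_add_mat[OF unit_matrix_carrier unit_matrix_carrier])
  have root: "root_mat l a b t \<in> elementary_matrices l"
    if ab: "a \<in> labels l - {0}" "b \<in> labels l - {0}" "a \<noteq> b" "a \<noteq> - b" for a b and t :: 'k
  proof -
    \<comment> \<open>The pairs \<open>(a, b)\<close> and \<open>(- b, - a)\<close> give the same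
      matrix; signs and order decide which of the two meets the side condition of a
      constructor.\<close>
    consider "a > 0" "b > 0" | "a < 0" "b < 0" | "a > 0" "b < 0" "a < - b" | "a > 0" "b < 0" "- b < a"
      | "a < 0" "b > 0" "- a < b" | "a < 0" "b > 0" "b < - a"
      using ab by force
    then show ?thesis
    proof cases
      case 1
      then show ?thesis
        using ab elementary_matrices.x_pos_pos[of a l b t] by (simp add: diff root_mat_def)
    next
      case 2
      then show ?thesis
        using ab elementary_matrices.x_pos_pos[of "- b" l "- a" t]
        by (simp add: diff root_mat_def comm[of a b])
    next
      case 3
      then show ?thesis
        using ab elementary_matrices.x_pos_neg[of a l "- b" t] by (simp add: diff root_mat_def)
    next
      case 4
      then show ?thesis
        using ab elementary_matrices.x_pos_neg[of "- b" l a t]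
        by (simp add: diff root_mat_def comm[of a b])
    next
      case 5
      then show ?thesis
        using ab elementary_matrices.x_neg_pos[of "- a" l b t] by (simp add: diff root_mat_def)
    next
      case 6
      then show ?thesis
        using ab elementary_matrices.x_neg_pos[of b l "- a" t]
        by (simp add: diff root_mat_def comm[of a b])
    qed
  qed
  have root0: "root0_mat l a t \<in> elementary_matrices l" if a: "a \<in> labels l - {0}" for a and t :: 'k
  proof (cases "a > 0")
    case True
    then show ?thesis
      using a elementary_matrices.x_pos_zero[of a l t] by (simp add: root0_mat_def)
  next
    case False
    then show ?thesis
      using a elementary_matrices.x_zero_pos[of "- a" l t] by (simp add: root0_mat_def)
  qed
  show ?thesis
  proof (intro equalityI subsetI)
    fix M :: "'k mat" assume "M \<in> elementary_matrices l"
    then show "M \<in> ?R \<union> ?Z"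
    proof cases
      case (x_pos_pos i j t)
      then have "M = root_mat l i j t" by (simp add: root_mat_def diff)
      moreover have "i \<in> labels l - {0}" "j \<in> labels l - {0}" "i \<noteq> j" "i \<noteq> - j"
        using x_pos_pos by auto
      ultimately show ?thesis by blast
    next
      case (x_pos_neg i j t)
      then have "M = root_mat l i (- j) t" by (simp add: root_mat_def diff)
      moreover have "i \<in> labels l - {0}" "- j \<in> labels l - {0}" "i \<noteq> - j" "i \<noteq> - (- j)"
        using x_pos_neg by auto
      ultimately show ?thesis by blast
    next
      case (x_neg_pos i j t)
      then have "M = root_mat l (- i) j t" by (simp add: root_mat_def diff)
      moreover have "- i \<in> labels l - {0}" "j \<in> labels l - {0}" "- i \<noteq> j" "- i \<noteq> - j"
        using x_neg_pos by auto
      ultimately show ?thesis by blast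
    next
      case (x_pos_zero i t)
      then have "M = root0_mat l i t" by (simp add: root0_mat_def)
      moreover have "i \<in> labels l - {0}" using x_pos_zero by auto
      ultimately show ?thesis by blast
    next
      case (x_zero_pos i t)
      then have "M = root0_mat l (- i) t" by (simp add: root0_mat_def)
      moreover have "- i \<in> labels l - {0}" using x_zero_pos by auto
      ultimately show ?thesis by blast
    qed
  qed (use root root0 in blast)
qed

text \<open>Exactly one of \<open>a\<close> and \<open>- a\<close> is positive, so a change in the
  hyperbolic pair of \<open>a\<close> enters the sum in \<open>quadratic_form\<close> once, whatever
  the sign of \<open>a\<close>.\<close>

lemma sum_labels_delta:
  assumes "a \<in> labels l - {0}"
  shows "(\<Sum>i = 1..int l. if i = a \<or> i = - a then s else 0) = (s::'a::comm_monoid_add)"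
proof -
  have "(\<Sum>i = 1..int l. if i = a \<or> i = - a then s else 0) = (\<Sum>i = 1..int l. if i = \<bar>a\<bar> then s else 0)"
    by (intro sum.cong) auto
  also have "\<dots> = s" using assms by (subst sum.delta) auto
  finally show ?thesis .
qed

text \<open>Coordinate \<open>a\<close> gains \<open>t\<close> times coordinate \<open>b\<close>,
  and coordinate \<open>- b\<close> gains \<open>t\<close> times coordinate \<open>- a\<close>. The
  summands of the two distinct pairs of \<open>a\<close> and \<open>b\<close> therefore change by
  the same \<open>s\<close>, and \<open>s + s = 0\<close>.\<close>

lemma quadratic_form_root_mat:
  fixes x :: "'k::field vec"
  assumes char2: "CHAR('k) = 2" and x: "x \<in> carrier_vec (2 * l + 1)"
    and ab: "a \<in> labels l - {0}" "b \<in> labels l - {0}" "a \<noteq> b" "a \<noteq> - b"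
  shows "quadratic_form l (root_mat l a b t *\<^sub>v x) = quadratic_form l x"
proof -
  define s where "s = t * x $ pos l b * x $ pos l (- a)"
  have idx: "(root_mat l a b t *\<^sub>v x) $ pos l c = x $ pos l c
    + t * ((if c = a then x $ pos l b else 0) + (if c = - b then x $ pos l (- a) else 0))"
    if "c \<in> labels l" for c
    using ab x that by (intro root_mat_mult_index) auto
  have "(\<Sum>i = 1..int l. (root_mat l a b t *\<^sub>v x) $ pos l i * (root_mat l a b t *\<^sub>v x) $ pos l (- i))
    = (\<Sum>i = 1..int l. x $ pos l i * x $ pos l (- i) + (if i = a \<or> i = - a then s else 0)
        + (if i = b \<or> i = - b then s else 0))"
    using ab by (intro sum.cong refl) (auto simp: idx s_def algebra_simps)
  also have "\<dots> = (\<Sum>i = 1..int l. x $ pos l i * x $ pos l (- i)) + (s + s)"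
    by (simp only: sum.distrib sum_labels_delta[OF ab(1)] sum_labels_delta[OF ab(2)] add.assoc)
  finally show ?thesis
    using ab by (simp add: quadratic_form_def idx char2_double[OF char2])
qed

text \<open>Squaring is additive in characteristic 2, so the square at label 0 changes by exactly
  \<open>s\<close>. The summand of the pair of \<open>a\<close> changes by \<open>s\<close> too, and
  the two changes cancel.\<close>

lemma quadratic_form_root0_mat:
  fixes x :: "'k::field vec"
  assumes char2: "CHAR('k) = 2" and x: "x \<in> carrier_vec (2 * l + 1)" and a: "a \<in> labels l - {0}"
  shows "quadratic_form l (root0_mat l a t *\<^sub>v x) = quadratic_form l x"
proof -
  define s where "s = (t * x $ pos l (- a))\<^sup>2"
  have idx: "(root0_mat l a t *\<^sub>v x) $ pos l c = x $ pos l c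
    + (if c = 0 then t * x $ pos l (- a) else 0) + (if c = a then t\<^sup>2 * x $ pos l (- a) else 0)"
    if "c \<in> labels l" for c
    using a x that by (intro root0_mat_mult_index) auto
  have "(\<Sum>i = 1..int l. (root0_mat l a t *\<^sub>v x) $ pos l i * (root0_mat l a t *\<^sub>v x) $ pos l (- i))
    = (\<Sum>i = 1..int l. x $ pos l i * x $ pos l (- i) + (if i = a \<or> i = - a then s else 0))"
    using a by (intro sum.cong refl) (auto simp: idx s_def algebra_simps power2_eq_square)
  also have "\<dots> = (\<Sum>i = 1..int l. x $ pos l i * x $ pos l (- i)) + s"
    by (simp only: sum.distrib sum_labels_delta[OF a])
  finally have 1: "(\<Sum>i = 1..int l. (root0_mat l a t *\<^sub>v x) $ pos l i * (root0_mat l a t *\<^sub>v x) $ pos l (- i))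
    = (\<Sum>i = 1..int l. x $ pos l i * x $ pos l (- i)) + s" .
  have "((root0_mat l a t *\<^sub>v x) $ pos l 0)\<^sup>2 = (x $ pos l 0)\<^sup>2 + s"
    using a char2_double[OF char2, of "x $ pos l 0 * (t * x $ pos l (- a))"]
    by (simp add: idx s_def power2_eq_square algebra_simps)
  then show ?thesis
    using char2_double[OF char2, of s] by (simp add: quadratic_form_def 1 algebra_simps)
qed

text \<open>The matrix changes only coordinates \<open>a\<close> and \<open>- b\<close> and reads
  only the unchanged coordinates \<open>b\<close> and \<open>- a\<close>, so a second application
  adds the same amounts again.\<close>

lemma root_mat_involution:
  assumes char2: "CHAR('k::field) = 2"
    and ab: "a \<in> labels l - {0}" "b \<in> labels l - {0}" "a \<noteq> b" "a \<noteq> - b"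
  shows "root_mat l a b t * root_mat l a b t = (1\<^sub>m (2 * l + 1) :: 'k mat)"
proof (rule eq_mat_unit_vecI[of _ "2 * l + 1"])
  fix i assume "i < 2 * l + 1"
  let ?x = "unit_vec (2 * l + 1) i :: 'k vec"
  note carr = mult_mat_vec_carrier[OF root_mat_carrier]
  have "root_mat l a b t *\<^sub>v (root_mat l a b t *\<^sub>v ?x) = ?x"
  proof (rule eq_vec_labelsI[of _ l])
    fix c assume c: "c \<in> labels l"
    show "(root_mat l a b t *\<^sub>v (root_mat l a b t *\<^sub>v ?x)) $ pos l c = ?x $ pos l c"
      using ab c carr[of ?x l a b t] char2_double[OF char2]
      by (auto simp: root_mat_mult_index add.assoc simp flip: distrib_left simp del: index_unit_vec)
  qed (auto intro!: carr)
  then show "root_mat l a b t * root_mat l a b t *\<^sub>v ?x = 1\<^sub>m (2 * l + 1) *\<^sub>v ?x"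
    by (simp add: assoc_mult_mat_vec[OF root_mat_carrier root_mat_carrier])
qed (auto intro!: mult_carrier_mat[of _ _ "2 * l + 1"])

lemma root0_mat_involution:
  assumes char2: "CHAR('k::field) = 2" and a: "a \<in> labels l - {0}"
  shows "root0_mat l a t * root0_mat l a t = (1\<^sub>m (2 * l + 1) :: 'k mat)"
proof (rule eq_mat_unit_vecI[of _ "2 * l + 1"])
  fix i assume "i < 2 * l + 1"
  let ?x = "unit_vec (2 * l + 1) i :: 'k vec"
  note carr = mult_mat_vec_carrier[OF root0_mat_carrier]
  have "root0_mat l a t *\<^sub>v (root0_mat l a t *\<^sub>v ?x) = ?x"
  proof (rule eq_vec_labelsI[of _ l])
    fix c assume c: "c \<in> labels l"
    show "(root0_mat l a t *\<^sub>v (root0_mat l a t *\<^sub>v ?x)) $ pos l c = ?x $ pos l c"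
      using a c carr[of ?x l a t] char2_double[OF char2]
      by (auto simp: root0_mat_mult_index add.assoc simp flip: distrib_left simp del: index_unit_vec)
  qed (auto intro!: carr)
  then show "root0_mat l a t * root0_mat l a t *\<^sub>v ?x = 1\<^sub>m (2 * l + 1) *\<^sub>v ?x"
    by (simp add: assoc_mult_mat_vec[OF root0_mat_carrier root0_mat_carrier])
qed (auto intro!: mult_carrier_mat[of _ _ "2 * l + 1"])

section \<open>Isometries of the quadratic form\<close>

definition isometries :: "nat \<Rightarrow> 'a::field mat set" where
  "isometries l = {g \<in> carrier_mat (2 * l + 1) (2 * l + 1).
     \<forall>x \<in> carrier_vec (2 * l + 1). quadratic_form l (g *\<^sub>v x) = quadratic_form l x}"

lemma isometries_mult:
  assumes "g \<in> isometries l" "h \<in> isometries l"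
  shows "g * h \<in> isometries l"
  using assms mult_mat_vec_carrier[of h "2 * l + 1" "2 * l + 1"]
    assoc_mult_mat_vec[of g "2 * l + 1" "2 * l + 1" h "2 * l + 1"]
  unfolding isometries_def by auto

lemma elementary_isometry:
  assumes "CHAR('k::field) = 2"
  shows "elementary_matrices l \<subseteq> (isometries l :: 'k mat set)"
  using assms unfolding elementary_matrices_char2[OF assms] isometries_def
  by (auto simp: quadratic_form_root_mat quadratic_form_root0_mat)

lemma elementary_involution:
  assumes "CHAR('k::field) = 2" "M \<in> elementary_matrices l"
  shows "M * M = (1\<^sub>m (2 * l + 1) :: 'k mat)"
  using assms(2) unfolding elementary_matrices_char2[OF assms(1)]
  by (auto simp: root_mat_involution[OF assms(1)] root0_mat_involution[OF assms(1)])

section \<open>Products of elementary matrices\<close>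

text \<open>Factors are attached on the left, as \<open>foldr\<close> does in
  \<open>mat_product\<close>; the induction rule then strips them off one by one.\<close>

inductive_set elementary_products :: "nat \<Rightarrow> 'a::field mat set" for l :: nat where
  one: "1\<^sub>m (2 * l + 1) \<in> elementary_products l"
| mult: "M \<in> elementary_matrices l \<Longrightarrow> h \<in> elementary_products l \<Longrightarrow> M * h \<in> elementary_products l"

lemma elementary_products_mat_product:
  "g \<in> elementary_products l \<Longrightarrow>
     \<exists>gs. set gs \<subseteq> elementary_matrices l \<and> g = mat_product (2 * l + 1) gs"
proof (induction rule: elementary_products.induct)
  case one
  show ?case by (intro exI[of _ "[]"]) (simp add: mat_product_def)
next
  case (mult M h)
  then obtain gs where "set gs \<subseteq> elementary_matrices l" "h = mat_product (2 * l + 1) gs" by blast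
  with mult.hyps show ?case by (intro exI[of _ "M # gs"]) (simp add: mat_product_def)
qed

lemma one_isometry: "1\<^sub>m (2 * l + 1) \<in> isometries l"
  by (simp add: isometries_def)

lemma isometry_carrier: "g \<in> isometries l \<Longrightarrow> g \<in> carrier_mat (2 * l + 1) (2 * l + 1)"
  by (simp add: isometries_def)

lemma elementary_products_isometry:
  assumes "CHAR('k::field) = 2" and "g \<in> elementary_products l"
  shows "g \<in> (isometries l :: 'k mat set)"
  using assms(2)
  by induction (use elementary_isometry[OF assms(1)] in \<open>auto intro: isometries_mult simp: one_isometry[simplified]\<close>)

lemma elementary_matrix_product:
  assumes "CHAR('k::field) = 2" and "M \<in> elementary_matrices l"
  shows "M \<in> (elementary_products l :: 'k mat set)"
proof -
  have "M \<in> carrier_mat (2 * l + 1) (2 * l + 1)"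
    using elementary_isometry[OF assms(1)] assms(2) isometry_carrier by blast
  then have "M * 1\<^sub>m (2 * l + 1) = M" by (rule right_mult_one_mat)
  then show ?thesis
    using elementary_products.mult[OF assms(2) elementary_products.one] by simp
qed

lemma elementary_products_mult:
  assumes char2: "CHAR('k::field) = 2" and "g \<in> elementary_products l" "h \<in> elementary_products l"
  shows "g * h \<in> (elementary_products l :: 'k mat set)"
  using assms(2)
proof induction
  case one
  have "1\<^sub>m (2 * l + 1) * h = h"
    using elementary_products_isometry[OF char2 assms(3)] isometry_carrier left_mult_one_mat by blast
  then show ?case using assms(3) by simp
next
  case (mult M g)
  have "M \<in> isometries l" "g \<in> isometries l" "h \<in> isometries l"
    using elementary_isometry[OF char2] mult.hyps elementary_products_isometry[OF char2] assms(3)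
    by blast+
  then have "(M * g) * h = M * (g * h)"
    by (metis isometry_carrier assoc_mult_mat)
  then show ?case using elementary_products.mult[OF mult.hyps(1) mult.IH] by simp
qed

text \<open>Every factor of \<open>h\<close> is its own inverse and can be moved to the other side.
  This turns a reduction of \<open>g\<close> by left multiplication into a factorization of
  \<open>g\<close>.\<close>

lemma elementary_products_cancel:
  assumes char2: "CHAR('k::field) = 2" and "h \<in> elementary_products l"
    and "h * g \<in> elementary_products l" "g \<in> carrier_mat (2 * l + 1) (2 * l + 1)"
  shows "g \<in> (elementary_products l :: 'k mat set)"
  using assms(2,3)
proof induction
  case one
  then show ?case using left_mult_one_mat[OF assms(4)] by simp
next
  case (mult M h)
  let ?n = "2 * l + 1"
  have M: "M \<in> carrier_mat ?n ?n" and h: "h \<in> carrier_mat ?n ?n"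
    using elementary_isometry[OF char2] mult.hyps elementary_products_isometry[OF char2] isometry_carrier
    by blast+
  have "M * (M * h * g) = (M * M) * (h * g)"
    using M h assms(4) by (simp add: assoc_mult_mat[of _ ?n ?n _ ?n _ ?n] mult_carrier_mat[of _ ?n ?n])
  also have "\<dots> = h * g"
    using elementary_involution[OF char2 mult.hyps(1)] left_mult_one_mat[OF mult_carrier_mat[OF h assms(4)]]
    by simp
  finally have "h * g \<in> elementary_products l"
    using elementary_products.mult[OF mult.hyps(1) mult.prems] by simp
  then show ?case by (rule mult.IH)
qed

section \<open>Moving a singular vector to a basis vector\<close>

text \<open>Only the columns labelled \<open>b\<close> and \<open>- a\<close> differ from those of
  the identity. This controls which basis vectors survive a reduction step.\<close>

lemma root_mat_fixes_basis_vec: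
  assumes "a \<in> labels l" "b \<in> labels l" "d \<in> labels l" "d \<noteq> b" "d \<noteq> - a"
  shows "root_mat l a b (t::'a::field) *\<^sub>v basis_vec l d = basis_vec l d"
  using assms
  by (intro eq_vec_labelsI[of _ l] mult_mat_vec_carrier[OF root_mat_carrier])
    (auto simp: root_mat_mult_index basis_vec_index simp del: index_unit_vec)

lemma root0_mat_fixes_basis_vec:
  assumes "a \<in> labels l" "d \<in> labels l" "d \<noteq> - a"
  shows "root0_mat l a (t::'a::field) *\<^sub>v basis_vec l d = basis_vec l d"
  using assms
  by (intro eq_vec_labelsI[of _ l] mult_mat_vec_carrier[OF root0_mat_carrier])
    (auto simp: root0_mat_mult_index basis_vec_index simp del: index_unit_vec)

lemma root_mat_product:
  assumes "CHAR('k::field) = 2"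
    and "a \<in> labels l - {0}" "b \<in> labels l - {0}" "a \<noteq> b" "a \<noteq> - b"
  shows "root_mat l a b (t::'k) \<in> elementary_products l"
  using assms by (intro elementary_matrix_product) (auto simp: elementary_matrices_char2)

lemma root0_mat_product:
  assumes "CHAR('k::field) = 2" and "a \<in> labels l - {0}"
  shows "root0_mat l a (t::'k) \<in> elementary_products l"
  using assms by (intro elementary_matrix_product) (auto simp: elementary_matrices_char2)

lemma elementary_products_carrier:
  assumes "CHAR('k::field) = 2" and "g \<in> elementary_products l"
  shows "(g :: 'k mat) \<in> carrier_mat (2 * l + 1) (2 * l + 1)"
  using elementary_products_isometry[OF assms] isometry_carrier by blast

text \<open>As coordinate \<open>c\<close> is 1, \<open>root_mat l a c\<close> with parameter
  \<open>v $ pos l a\<close> doubles coordinate \<open>a\<close> to 0. Its side effect falls on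
  coordinate \<open>- c\<close>, about which nothing is claimed, and it moves only the basis vectors
  at \<open>c\<close> and \<open>- a\<close>.\<close>

lemma clear_coordinates:
  fixes v :: "'k::field vec"
  assumes char2: "CHAR('k) = 2" and c: "c \<in> labels l - {0}"
    and v: "v \<in> carrier_vec (2 * l + 1)" "v $ pos l c = 1"
    and S: "finite S" "S \<subseteq> labels l - {0, c, - c}"
  shows "\<exists>h \<in> elementary_products l.
    (\<forall>d \<in> labels l. d \<noteq> - c \<longrightarrow> (h *\<^sub>v v) $ pos l d = (if d \<in> S then 0 else v $ pos l d)) \<and>
    (\<forall>d \<in> labels l. d \<noteq> c \<and> - d \<notin> S \<longrightarrow> h *\<^sub>v basis_vec l d = basis_vec l d)"
  using S
proof induction
  case empty
  show ?case using v by (intro bexI[OF _ elementary_products.one]) auto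
next
  case (insert a S)
  then obtain h where h: "h \<in> elementary_products l"
    and hv: "\<And>d. d \<in> labels l \<Longrightarrow> d \<noteq> - c \<Longrightarrow> (h *\<^sub>v v) $ pos l d = (if d \<in> S then 0 else v $ pos l d)"
    and hfix: "\<And>d. d \<in> labels l \<Longrightarrow> d \<noteq> c \<Longrightarrow> - d \<notin> S \<Longrightarrow> h *\<^sub>v basis_vec l d = basis_vec l d"
    by auto
  let ?n = "2 * l + 1"
  \<comment> \<open>The parameter can be read from the original \<open>v\<close>: since
    \<open>a\<close> and \<open>c\<close> are outside \<open>S\<close> and differ from
    \<open>- c\<close>, \<open>h\<close> has not changed these coordinates.\<close>
  let ?M = "root_mat l a c (v $ pos l a)"
  have a: "a \<in> labels l - {0}" "a \<noteq> c" "a \<noteq> - c" "c \<in> labels l" "c \<noteq> - c" "c \<notin> S"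
    using insert.prems c by auto
  have hc: "h \<in> carrier_mat ?n ?n" by (rule elementary_products_carrier[OF char2 h])
  have hvc: "h *\<^sub>v v \<in> carrier_vec ?n" using hc v by (rule_tac mult_mat_vec_carrier)
  have comp: "?M * h *\<^sub>v x = ?M *\<^sub>v (h *\<^sub>v x)" if "x \<in> carrier_vec ?n" for x
    using that by (rule assoc_mult_mat_vec[OF root_mat_carrier hc])
  show ?case
  proof (intro bexI[of _ "?M * h"] conjI ballI impI)
    show "?M * h \<in> elementary_products l"
      using a c h by (intro elementary_products_mult[OF char2] root_mat_product[OF char2]) auto
  next
    fix d assume d: "d \<in> labels l" "d \<noteq> - c"
    have "(?M * h *\<^sub>v v) $ pos l d = (h *\<^sub>v v) $ pos l d + v $ pos l a * (if d = a then 1 else 0)"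
      using a d hvc v hv[of c] by (auto simp: comp root_mat_mult_index)
    then show "(?M * h *\<^sub>v v) $ pos l d = (if d \<in> insert a S then 0 else v $ pos l d)"
      using hv[OF d] insert.hyps char2_double[OF char2] by auto
  next
    fix d assume d: "d \<in> labels l" "d \<noteq> c \<and> - d \<notin> insert a S"
    then have "h *\<^sub>v basis_vec l d = basis_vec l d" "d \<noteq> - a"
      using hfix by auto
    then show "?M * h *\<^sub>v basis_vec l d = basis_vec l d"
      using a d comp[OF unit_vec_carrier] root_mat_fixes_basis_vec[of a l c d "v $ pos l a"] by auto
  qed
qed

lemma quadratic_form_hyperbolic:
  assumes c: "c \<in> labels l - {0}" and "\<And>d. d \<in> labels l \<Longrightarrow> d \<noteq> c \<Longrightarrow> d \<noteq> - c \<Longrightarrow> x $ pos l d = 0"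
  shows "quadratic_form l x = x $ pos l c * (x $ pos l (- c) :: 'a::field)"
proof -
  have "(\<Sum>i = 1..int l. x $ pos l i * x $ pos l (- i))
      = (\<Sum>i = 1..int l. if i = c \<or> i = - c then x $ pos l c * x $ pos l (- c) else 0)"
    using assms by (intro sum.cong) auto
  also have "\<dots> = x $ pos l c * x $ pos l (- c)" by (rule sum_labels_delta[OF c])
  finally show ?thesis using assms by (simp add: quadratic_form_def)
qed

text \<open>Coordinates outside the pair of \<open>c\<close> are cleared first, then the one at 0,
  and singularity settles the one at \<open>- c\<close>. The second clause protects vectors already
  fixed; it always includes the basis vector at \<open>- c\<close>.\<close>

lemma elementary_products_move_normalized:
  fixes v :: "'k::field vec"
  assumes char2: "CHAR('k) = 2" and c: "c \<in> labels l - {0}"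
    and v: "v \<in> carrier_vec (2 * l + 1)" "v $ pos l c = 1" "quadratic_form l v = 0"
  shows "\<exists>h \<in> elementary_products l. h *\<^sub>v v = basis_vec l c \<and>
    (\<forall>d \<in> labels l. d \<noteq> c \<and> (d = - c \<or> v $ pos l (- d) = 0) \<longrightarrow> h *\<^sub>v basis_vec l d = basis_vec l d)"
proof -
  let ?n = "2 * l + 1"
  \<comment> \<open>Zero coordinates are left out, so that no factor moves the basis vector at
    \<open>d\<close> when \<open>v\<close> vanishes at \<open>- d\<close>.\<close>
  let ?S = "{d \<in> labels l. d \<noteq> 0 \<and> d \<noteq> c \<and> d \<noteq> - c \<and> v $ pos l d \<noteq> 0}"
  have S: "finite ?S" "?S \<subseteq> labels l - {0, c, - c}"
    by (auto intro: finite_subset[of _ "labels l"])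
  from clear_coordinates[OF char2 c v(1,2) S]
  obtain h where h: "h \<in> elementary_products l"
    and hv: "\<And>d. d \<in> labels l \<Longrightarrow> d \<noteq> - c \<Longrightarrow> (h *\<^sub>v v) $ pos l d = (if d \<in> ?S then 0 else v $ pos l d)"
    and hfix: "\<And>d. d \<in> labels l \<Longrightarrow> d \<noteq> c \<Longrightarrow> - d \<notin> ?S \<Longrightarrow> h *\<^sub>v basis_vec l d = basis_vec l d"
    by blast
  \<comment> \<open>Since coordinate \<open>c\<close> is 1, this doubles coordinate 0 to 0;
    otherwise it changes only coordinate \<open>- c\<close>.\<close>
  let ?M = "root0_mat l (- c) (v $ pos l 0)"
  have hc: "h \<in> carrier_mat ?n ?n" by (rule elementary_products_carrier[OF char2 h])
  have hvc: "h *\<^sub>v v \<in> carrier_vec ?n" using hc v(1) by (rule_tac mult_mat_vec_carrier)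
  have comp: "?M * h *\<^sub>v x = ?M *\<^sub>v (h *\<^sub>v x)" if "x \<in> carrier_vec ?n" for x
    using that by (rule assoc_mult_mat_vec[OF root0_mat_carrier hc])
  have Mh: "?M * h \<in> elementary_products l"
    using c h by (intro elementary_products_mult[OF char2] root0_mat_product[OF char2]) auto
  define w where "w = ?M * h *\<^sub>v v"
  have w: "w \<in> carrier_vec ?n"
    unfolding w_def using elementary_products_carrier[OF char2 Mh] v(1) by (rule_tac mult_mat_vec_carrier)
  have wd: "w $ pos l d = (if d = c then 1 else 0)" if d: "d \<in> labels l" "d \<noteq> - c" for d
  proof -
    have "(h *\<^sub>v v) $ pos l c = 1" using hv[of c] c v by auto
    then have "w $ pos l d = (h *\<^sub>v v) $ pos l d + (if d = 0 then v $ pos l 0 else 0)"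
      unfolding w_def comp[OF v(1)] using c d hvc by (auto simp: root0_mat_mult_index)
    then show ?thesis
      using hv[OF d] c d v char2_double[OF char2] by auto
  qed
  \<comment> \<open>The clearing steps leave coordinate \<open>- c\<close> unknown. The form of
    \<open>w\<close> is now the product of coordinates \<open>c\<close> and \<open>- c\<close>, the
    first of which is 1.\<close>
  have "quadratic_form l w = 0"
    using elementary_products_isometry[OF char2 Mh] v unfolding w_def isometries_def by auto
  moreover have "quadratic_form l w = w $ pos l c * w $ pos l (- c)"
    using wd by (intro quadratic_form_hyperbolic[OF c]) auto
  ultimately have "w $ pos l (- c) = 0" using wd[of c] c by auto
  then have "w $ pos l d = basis_vec l c $ pos l d" if "d \<in> labels l" for d
    using wd[OF that] basis_vec_index[where 'a = 'k, of d l c] c that by (cases "d = - c") auto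
  then have "w = basis_vec l c"
    using eq_vec_labelsI[OF w unit_vec_carrier] by blast
  moreover have "?M * h *\<^sub>v basis_vec l d = basis_vec l d"
    if "d \<in> labels l" "d \<noteq> c \<and> (d = - c \<or> v $ pos l (- d) = 0)" for d
    using c that comp[OF unit_vec_carrier] hfix[of d] root0_mat_fixes_basis_vec[of "- c" l d "v $ pos l 0"] by auto
  ultimately show ?thesis using Mh unfolding w_def by blast
qed

text \<open>This is where perfectness enters: within the pair of \<open>c\<close>, coordinate
  \<open>c\<close> can only be changed by a square times coordinate \<open>- c\<close>. A nonzero
  coordinate outside the pair allows any change. The last clause keeps earlier progress, because
  \<open>v\<close> is nonzero at \<open>a\<close> and so \<open>a\<close> is neither
  \<open>d\<close> nor \<open>- d\<close>.\<close>

lemma elementary_products_normalize: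
  fixes v :: "'k::field vec"
  assumes perfect: "perfect_field TYPE('k)" and char2: "CHAR('k) = 2" and c: "c \<in> labels l - {0}"
    and v: "v \<in> carrier_vec (2 * l + 1)"
    and a: "a \<in> labels l - {0}" "v $ pos l a \<noteq> 0"
  shows "\<exists>h \<in> elementary_products l. (h *\<^sub>v v) $ pos l c = 1 \<and>
    (\<forall>d \<in> labels l - {0, c, - c}. v $ pos l d = 0 \<and> v $ pos l (- d) = 0 \<longrightarrow>
      (h *\<^sub>v v) $ pos l d = 0 \<and> h *\<^sub>v basis_vec l d = basis_vec l d)"
proof -
  let ?n = "2 * l + 1"
  \<comment> \<open>Stated for arbitrary \<open>u\<close>, because the last case applies it to a
    modified vector.\<close>
  have neg: "\<exists>h \<in> elementary_products l. (h *\<^sub>v u) $ pos l c = 1 \<and>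
    (\<forall>d \<in> labels l - {0, c, - c}. u $ pos l d = 0 \<longrightarrow>
      (h *\<^sub>v u) $ pos l d = 0 \<and> h *\<^sub>v basis_vec l d = basis_vec l d)"
    if u: "u \<in> carrier_vec ?n" "u $ pos l (- c) \<noteq> 0" for u :: "'k vec"
  proof -
    obtain t where t: "t\<^sup>2 = (1 - u $ pos l c) / u $ pos l (- c)"
      using perfect_char2_sqrt[OF perfect char2] .
    show ?thesis
      using c u t root0_mat_product[OF char2 c, of t] root0_mat_fixes_basis_vec[of c l _ t]
      by (intro bexI[of _ "root0_mat l c t"]) (auto simp: root0_mat_mult_index)
  qed
  consider "a \<noteq> c" "a \<noteq> - c" | "v $ pos l (- c) \<noteq> 0" | "v $ pos l c \<noteq> 0" "v $ pos l (- c) = 0"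
    using a by auto
  then show ?thesis
  proof cases
    case 1
    let ?M = "root_mat l c a ((1 - v $ pos l c) / v $ pos l a)"
    have "?M \<in> elementary_products l" using 1 a c by (intro root_mat_product[OF char2]) auto
    moreover have "(?M *\<^sub>v v) $ pos l c = 1" using 1 a c v by (auto simp: root_mat_mult_index)
    moreover have "(?M *\<^sub>v v) $ pos l d = 0 \<and> ?M *\<^sub>v basis_vec l d = basis_vec l d"
      if d: "d \<in> labels l - {0, c, - c}" "v $ pos l d = 0 \<and> v $ pos l (- d) = 0" for d
    proof -
      have "d \<noteq> a" "d \<noteq> - a" using a d by auto
      then show ?thesis
        using a c d v root_mat_fixes_basis_vec[of c l a d "(1 - v $ pos l c) / v $ pos l a"] by (auto simp: root_mat_mult_index)
    qed
    ultimately show ?thesis by blast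
  next
    case 2
    then show ?thesis using neg[OF v] by blast
  next
    case 3
    \<comment> \<open>This adds coordinate \<open>c\<close>, which is nonzero, to the vanishing
      coordinate \<open>- c\<close> and so reduces to \<open>neg\<close>.\<close>
    let ?M = "root0_mat l (- c) 1"
    let ?u = "?M *\<^sub>v v"
    have u: "?u \<in> carrier_vec ?n" using v by (rule mult_mat_vec_carrier[OF root0_mat_carrier])
    have ud: "?u $ pos l d = v $ pos l d" if "d \<in> labels l - {0, - c}" for d
      using c v that by (auto simp: root0_mat_mult_index)
    have "?u $ pos l (- c) \<noteq> 0" using 3 c v by (auto simp: root0_mat_mult_index)
    from neg[OF u this] obtain h where h: "h \<in> elementary_products l" "(h *\<^sub>v ?u) $ pos l c = 1"
      and hfix: "\<And>d. d \<in> labels l - {0, c, - c} \<Longrightarrow> ?u $ pos l d = 0 \<Longrightarrow>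
        (h *\<^sub>v ?u) $ pos l d = 0 \<and> h *\<^sub>v basis_vec l d = basis_vec l d"
      by blast
    have comp: "h * ?M *\<^sub>v x = h *\<^sub>v (?M *\<^sub>v x)" if "x \<in> carrier_vec ?n" for x
      using that by (rule assoc_mult_mat_vec[OF elementary_products_carrier[OF char2 h(1)] root0_mat_carrier])
    have "h * ?M \<in> elementary_products l"
      using c h by (intro elementary_products_mult[OF char2] root0_mat_product[OF char2]) auto
    moreover have "(h * ?M *\<^sub>v v) $ pos l c = 1" using h comp[OF v] by simp
    moreover have "(h * ?M *\<^sub>v v) $ pos l d = 0 \<and> h * ?M *\<^sub>v basis_vec l d = basis_vec l d"
      if d: "d \<in> labels l - {0, c, - c}" "v $ pos l d = 0 \<and> v $ pos l (- d) = 0" for d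
      using c d ud[of d] hfix[of d] comp[OF v] comp[OF unit_vec_carrier]
        root0_mat_fixes_basis_vec[of "- c" l d "1 :: 'k"] by auto
    ultimately show ?thesis by blast
  qed
qed

lemma elementary_products_move:
  fixes v :: "'k::field vec"
  assumes perfect: "perfect_field TYPE('k)" and char2: "CHAR('k) = 2" and c: "c \<in> labels l - {0}"
    and v: "v \<in> carrier_vec (2 * l + 1)" "quadratic_form l v = 0"
    and a: "a \<in> labels l - {0}" "v $ pos l a \<noteq> 0"
  shows "\<exists>h \<in> elementary_products l. h *\<^sub>v v = basis_vec l c \<and>
    (\<forall>d \<in> labels l - {0, c, - c}. v $ pos l d = 0 \<and> v $ pos l (- d) = 0 \<longrightarrow>
      h *\<^sub>v basis_vec l d = basis_vec l d)"
proof -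
  let ?n = "2 * l + 1"
  from elementary_products_normalize[OF perfect char2 c v(1) a]
  obtain h where h: "h \<in> elementary_products l" "(h *\<^sub>v v) $ pos l c = 1"
    and hfix: "\<And>d. d \<in> labels l - {0, c, - c} \<Longrightarrow> v $ pos l d = 0 \<Longrightarrow> v $ pos l (- d) = 0 \<Longrightarrow>
      (h *\<^sub>v v) $ pos l d = 0 \<and> h *\<^sub>v basis_vec l d = basis_vec l d" by blast
  have hc: "h \<in> carrier_mat ?n ?n" by (rule elementary_products_carrier[OF char2 h(1)])
  then have hv: "h *\<^sub>v v \<in> carrier_vec ?n" using v by (rule_tac mult_mat_vec_carrier)
  have "quadratic_form l (h *\<^sub>v v) = 0"
    using elementary_products_isometry[OF char2 h(1)] v unfolding isometries_def by auto
  from elementary_products_move_normalized[OF char2 c hv h(2) this]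
  obtain k where k: "k \<in> elementary_products l" "k *\<^sub>v (h *\<^sub>v v) = basis_vec l c"
    and kfix: "\<And>d. d \<in> labels l \<Longrightarrow> d \<noteq> c \<Longrightarrow> (h *\<^sub>v v) $ pos l (- d) = 0 \<Longrightarrow>
      k *\<^sub>v basis_vec l d = basis_vec l d" by blast
  have comp: "k * h *\<^sub>v x = k *\<^sub>v (h *\<^sub>v x)" if "x \<in> carrier_vec ?n" for x
    using that by (rule assoc_mult_mat_vec[OF elementary_products_carrier[OF char2 k(1)] hc])
  \<comment> \<open>The assumption on \<open>d\<close> is symmetric under negation, so
    \<open>hfix\<close> at \<open>- d\<close> supplies the zero coordinate that \<open>kfix\<close>
    requires.\<close>
  have "k * h *\<^sub>v basis_vec l d = basis_vec l d"
    if d: "d \<in> labels l - {0, c, - c}" "v $ pos l d = 0 \<and> v $ pos l (- d) = 0" for d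
    using d hfix[of d] hfix[of "- d"] kfix[of d] comp[OF unit_vec_carrier] by auto
  then show ?thesis
    using elementary_products_mult[OF char2 k(1) h(1)] k(2) comp[OF v(1)] by auto
qed

section \<open>The polar form\<close>

text \<open>Defined by polarization, so that invariance under isometries follows from linearity
  alone.\<close>

definition polar_form :: "nat \<Rightarrow> 'a::field vec \<Rightarrow> 'a vec \<Rightarrow> 'a" where
  "polar_form l x y = quadratic_form l (x + y) - quadratic_form l x - quadratic_form l y"

lemma isometry_polar_form:
  assumes g: "g \<in> isometries l" and x: "x \<in> carrier_vec (2 * l + 1)" and y: "y \<in> carrier_vec (2 * l + 1)"
  shows "polar_form l (g *\<^sub>v x) (g *\<^sub>v y) = polar_form l x y"
proof -
  have "g *\<^sub>v (x + y) = g *\<^sub>v x + g *\<^sub>v y"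
    by (rule mult_add_distrib_mat_vec[OF isometry_carrier[OF g] x y])
  moreover have "quadratic_form l (g *\<^sub>v z) = quadratic_form l z" if "z \<in> carrier_vec (2 * l + 1)" for z
    using g that by (auto simp: isometries_def)
  ultimately show ?thesis
    using x y add_carrier_vec[OF x y] unfolding polar_form_def by metis
qed

lemma quadratic_form_basis_vec:
  assumes "a \<in> labels l - {0}"
  shows "quadratic_form l (basis_vec l a :: 'a::field vec) = 0"
proof -
  have "quadratic_form l (basis_vec l a :: 'a vec) = basis_vec l a $ pos l a * basis_vec l a $ pos l (- a)"
    using assms by (intro quadratic_form_hyperbolic) (auto simp: basis_vec_index simp del: index_unit_vec)
  then show ?thesis using assms by (auto simp: basis_vec_index simp del: index_unit_vec)
qed

lemma index_add_labels:
  assumes "y \<in> carrier_vec (2 * l + 1)" "a \<in> labels l"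
  shows "(x + y) $ pos l a = x $ pos l a + y $ pos l a"
  using assms pos_less[of a l] by simp

text \<open>Adding the basis vector at \<open>a\<close> changes only the summand of the pair of
  \<open>a\<close>. Coordinates at nonzero labels thus become values of an invariant form.\<close>

lemma polar_form_basis_vec:
  assumes x: "x \<in> carrier_vec (2 * l + 1)" and a: "a \<in> labels l - {0}"
  shows "polar_form l x (basis_vec l a) = (x $ pos l (- a) :: 'a::field)"
proof -
  define y where "y = x + basis_vec l a"
  have idx: "y $ pos l d = x $ pos l d + (if d = a then 1 else 0)" if "d \<in> labels l" for d
  proof -
    have "(basis_vec l a :: 'a vec) $ pos l d = (if d = a then 1 else 0)"
      using a that by (intro basis_vec_index) auto
    then show ?thesis by (simp only: y_def index_add_labels[OF unit_vec_carrier that])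
  qed
  have "(\<Sum>i = 1..int l. y $ pos l i * y $ pos l (- i))
    = (\<Sum>i = 1..int l. x $ pos l i * x $ pos l (- i) + (if i = a \<or> i = - a then x $ pos l (- a) else 0))"
    using a by (intro sum.cong refl) (auto simp: idx algebra_simps)
  then have "quadratic_form l y = quadratic_form l x + x $ pos l (- a)"
    using a by (simp add: quadratic_form_def idx sum.distrib sum_labels_delta)
  then show ?thesis
    unfolding polar_form_def quadratic_form_basis_vec[OF a] y_def by simp
qed

text \<open>On multiples of the basis vector at 0 the form is a square, which is additive in
  characteristic 2; these vectors therefore lie in the radical.\<close>

lemma polar_form_radical:
  assumes char2: "CHAR('k::field) = 2" and y: "y \<in> carrier_vec (2 * l + 1)"
    and x: "\<And>a. a \<in> labels l - {0} \<Longrightarrow> x $ pos l a = 0"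
  shows "polar_form l x y = (0 :: 'k)"
proof -
  have "polar_form l x y = x $ pos l 0 * y $ pos l 0 + x $ pos l 0 * y $ pos l 0"
    using x by (simp add: polar_form_def quadratic_form_def index_add_labels[OF y]
        power2_eq_square algebra_simps del: index_add_vec)
  then show ?thesis using char2_double[OF char2] by metis
qed

text \<open>Coordinate \<open>- d\<close> is the polar product with the basis vector at
  \<open>d\<close>, and \<open>g\<close> preserves both the product and that vector.\<close>

lemma isometry_fixed_coordinates:
  assumes g: "g \<in> isometries l" and d: "d \<in> labels l - {0}"
    and fixes_d: "g *\<^sub>v basis_vec l d = (basis_vec l d :: 'a::field vec)"
    and x: "x \<in> carrier_vec (2 * l + 1)"
  shows "(g *\<^sub>v x) $ pos l (- d) = x $ pos l (- d)"
proof -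
  have "g *\<^sub>v x \<in> carrier_vec (2 * l + 1)"
    using isometry_carrier[OF g] x by (rule mult_mat_vec_carrier)
  then show ?thesis
    using isometry_polar_form[OF g x unit_vec_carrier, of "pos l d"] fixes_d
      polar_form_basis_vec[OF _ d] x by metis
qed

lemma isometry_eq_one:
  assumes char2: "CHAR('k::field) = 2" and g: "g \<in> isometries l"
    and fix_basis: "\<And>d. d \<in> labels l - {0} \<Longrightarrow> g *\<^sub>v basis_vec l d = basis_vec l d"
  shows "g = (1\<^sub>m (2 * l + 1) :: 'k mat)"
proof (rule eq_mat_unit_vecI[OF isometry_carrier[OF g] one_carrier_mat])
  let ?n = "2 * l + 1"
  fix i assume "i < ?n"
  then obtain d where d: "d \<in> labels l" "i = pos l d" by (rule ex_label)
  have "g *\<^sub>v basis_vec l 0 = basis_vec l 0"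
  proof (rule eq_vec_labelsI[of _ l])
    show gc: "g *\<^sub>v basis_vec l 0 \<in> carrier_vec ?n"
      using isometry_carrier[OF g] unit_vec_carrier by (rule mult_mat_vec_carrier)
    fix a assume a: "a \<in> labels l"
    have eq: "(g *\<^sub>v basis_vec l 0) $ pos l b = (basis_vec l 0 :: 'k vec) $ pos l b"
      if "b \<in> labels l - {0}" for b
      using isometry_fixed_coordinates[OF g _ fix_basis unit_vec_carrier, of "- b" "pos l 0"] that by auto
    have Q: "quadratic_form l x = (x $ pos l 0)\<^sup>2"
      if "\<And>b. b \<in> labels l - {0} \<Longrightarrow> x $ pos l b = 0" for x :: "'k vec"
      using that by (simp add: quadratic_form_def)
    have zero: "(basis_vec l 0 :: 'k vec) $ pos l b = 0" if "b \<in> labels l - {0}" for b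
      using that basis_vec_index[where 'a = 'k, of b l 0] by auto
    have "quadratic_form l (g *\<^sub>v basis_vec l 0) = quadratic_form l (basis_vec l 0)"
      using g by (simp add: isometries_def)
    then have "((g *\<^sub>v basis_vec l 0) $ pos l 0)\<^sup>2 = ((basis_vec l 0 :: 'k vec) $ pos l 0)\<^sup>2"
      using Q[of "g *\<^sub>v basis_vec l 0"] Q[of "basis_vec l 0"] eq zero by metis
    \<comment> \<open>Equal squares give equality up to sign, and the sign is immaterial in
      characteristic 2.\<close>
    then have "(g *\<^sub>v basis_vec l 0) $ pos l 0 = (basis_vec l 0 :: 'k vec) $ pos l 0"
      using char2_diff[OF char2, of 0] by (auto simp: power2_eq_iff simp del: index_unit_vec)
    then show "(g *\<^sub>v basis_vec l 0) $ pos l a = (basis_vec l 0 :: 'k vec) $ pos l a"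
      using eq a by (cases "a = 0") blast+
  qed simp
  then show "g *\<^sub>v unit_vec ?n i = 1\<^sub>m ?n *\<^sub>v unit_vec ?n i"
    using d fix_basis by (cases "d = 0") auto
qed

section \<open>Reduction of an isometry to the identity\<close>

lemma isometry_elementary_product:
  assumes perfect: "perfect_field TYPE('k::field)" and char2: "CHAR('k) = 2"
    and "m \<le> l" and "g \<in> isometries l"
    and "\<And>d. d \<in> labels l - {0} \<Longrightarrow> \<bar>d\<bar> \<le> int m \<Longrightarrow> g *\<^sub>v basis_vec l d = basis_vec l d"
  shows "g \<in> (elementary_products l :: 'k mat set)"
  using assms(3-)
\<comment> \<open>The induction descends from \<open>m = l\<close>, where \<open>g\<close> is the
  identity; the step fixes the pair of label \<open>m + 1\<close> and uses the statement for
  \<open>Suc m\<close>.\<close>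
proof (induction m arbitrary: g rule: inc_induct)
  case base
  then have "g = 1\<^sub>m (2 * l + 1)" by (intro isometry_eq_one[OF char2]) auto
  then show ?case by (simp add: elementary_products.one)
next
  case (step m)
  let ?n = "2 * l + 1"
  define c where "c = int m + 1"
  have c: "c \<in> labels l - {0}" and negc: "- c \<in> labels l - {0}" and c0: "c \<noteq> - c"
    using step.hyps by (auto simp: c_def)
  note g = step.prems(1)
  let ?v = "g *\<^sub>v basis_vec l c"
  have v: "?v \<in> carrier_vec ?n"
    using isometry_carrier[OF g] unit_vec_carrier by (rule mult_mat_vec_carrier)
  have Qv: "quadratic_form l ?v = 0"
    using g quadratic_form_basis_vec[OF c] by (simp add: isometries_def)
  have polar1: "polar_form l (basis_vec l c) (basis_vec l (- c)) = (1::'k)"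
    using polar_form_basis_vec[of "basis_vec l c :: 'k vec" l "- c"] negc basis_vec_index[where 'a = 'k, of c l c] c by simp
  \<comment> \<open>Otherwise \<open>?v\<close> would be in the radical, although it pairs to 1 with
    the image of the basis vector at \<open>- c\<close>.\<close>
  have "\<exists>a \<in> labels l - {0}. ?v $ pos l a \<noteq> 0"
  proof (rule ccontr)
    assume "\<not> ?thesis"
    then have "polar_form l ?v (g *\<^sub>v basis_vec l (- c)) = 0"
      using isometry_carrier[OF g] unit_vec_carrier
      by (intro polar_form_radical[OF char2 mult_mat_vec_carrier]) auto
    then show False
      using isometry_polar_form[OF g unit_vec_carrier unit_vec_carrier] polar1 by simp
  qed
  then obtain a where a: "a \<in> labels l - {0}" "?v $ pos l a \<noteq> 0" by blast
  have v0: "?v $ pos l d = 0" if d: "d \<in> labels l - {0}" "\<bar>d\<bar> \<le> int m" for d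
  proof -
    have "?v $ pos l d = (basis_vec l c :: 'k vec) $ pos l d"
      using isometry_fixed_coordinates[OF g _ step.prems(2) unit_vec_carrier, of "- d"] d by auto
    then show ?thesis using basis_vec_index[where 'a = 'k, of d l c] c d by (auto simp: c_def)
  qed
  from elementary_products_move[OF perfect char2 c v Qv a]
  obtain h where h: "h \<in> elementary_products l" "h *\<^sub>v ?v = basis_vec l c"
    and hfix: "\<And>d. d \<in> labels l - {0, c, - c} \<Longrightarrow> ?v $ pos l d = 0 \<Longrightarrow> ?v $ pos l (- d) = 0 \<Longrightarrow>
      h *\<^sub>v basis_vec l d = basis_vec l d" by blast
  define f where "f = h * g"
  have f: "f \<in> isometries l"
    unfolding f_def using elementary_products_isometry[OF char2 h(1)] g by (rule isometries_mult)
  have fx: "f *\<^sub>v x = h *\<^sub>v (g *\<^sub>v x)" if "x \<in> carrier_vec ?n" for x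
    unfolding f_def using that
    by (rule assoc_mult_mat_vec[OF elementary_products_carrier[OF char2 h(1)] isometry_carrier[OF g]])
  have small: "d \<noteq> c" "d \<noteq> - c" if "\<bar>d\<bar> \<le> int m" for d
    using that by (auto simp: c_def)
  have ffix: "f *\<^sub>v basis_vec l d = basis_vec l d" if d: "d \<in> labels l - {0}" "\<bar>d\<bar> \<le> int m" for d
    using d step.prems(2)[OF d] hfix[of d] v0[of d] v0[of "- d"] fx[OF unit_vec_carrier] small[OF d(2)]
    by auto
  have fc: "f *\<^sub>v basis_vec l c = basis_vec l c" using h fx[OF unit_vec_carrier] by simp
  let ?w = "f *\<^sub>v basis_vec l (- c)"
  have w: "?w \<in> carrier_vec ?n"
    using isometry_carrier[OF f] unit_vec_carrier by (rule mult_mat_vec_carrier)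
  have Qw: "quadratic_form l ?w = 0"
    using f quadratic_form_basis_vec[OF negc] by (simp add: isometries_def)
  have wc: "?w $ pos l (- c) = 1"
    using isometry_fixed_coordinates[OF f c fc unit_vec_carrier] basis_vec_index[where 'a = 'k, of "- c" l "- c"] negc
    by auto
  have w0: "?w $ pos l (- d) = 0" if d: "d \<in> labels l - {0}" "\<bar>d\<bar> \<le> int m" for d
    using isometry_fixed_coordinates[OF f d(1) ffix[OF d] unit_vec_carrier]
      basis_vec_index[where 'a = 'k, of "- d" l "- c"] negc d small[OF d(2)] by auto
  \<comment> \<open>With \<open>- c\<close> as the target label, the vector that is always protected
    is the one at \<open>c\<close>, which \<open>f\<close> already fixes. By \<open>w0\<close> the
    earlier pairs are protected as well.\<close>
  from elementary_products_move_normalized[OF char2 negc w wc Qw]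
  obtain k where k: "k \<in> elementary_products l" "k *\<^sub>v ?w = basis_vec l (- c)"
    and kfix: "\<And>d. d \<in> labels l \<Longrightarrow> d \<noteq> - c \<Longrightarrow> d = c \<or> ?w $ pos l (- d) = 0 \<Longrightarrow>
      k *\<^sub>v basis_vec l d = basis_vec l d" by auto
  have kf: "k * f \<in> isometries l"
    using elementary_products_isometry[OF char2 k(1)] f by (rule isometries_mult)
  have kfx: "k * f *\<^sub>v x = k *\<^sub>v (f *\<^sub>v x)" if "x \<in> carrier_vec ?n" for x
    using that
    by (rule assoc_mult_mat_vec[OF elementary_products_carrier[OF char2 k(1)] isometry_carrier[OF f]])
  have "k * f \<in> elementary_products l"
  proof (rule step.IH[OF kf])
    fix d assume d: "d \<in> labels l - {0}" "\<bar>d\<bar> \<le> int (Suc m)"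
    then consider "\<bar>d\<bar> \<le> int m" | "d = c" | "d = - c" by (force simp: c_def)
    then show "k * f *\<^sub>v basis_vec l d = basis_vec l d"
    proof cases
      case 1
      then show ?thesis
        using d ffix[of d] w0[of d] kfix[of d] kfx[OF unit_vec_carrier] small[of d] by auto
    next
      case 2
      then show ?thesis using fc kfix[of c] c c0 kfx[OF unit_vec_carrier] by auto
    next
      case 3
      then show ?thesis using k(2) kfx[OF unit_vec_carrier] by simp
    qed
  qed
  then have "f \<in> elementary_products l"
    by (rule elementary_products_cancel[OF char2 k(1) _ isometry_carrier[OF f]])
  then show ?case
    unfolding f_def by (rule elementary_products_cancel[OF char2 h(1) _ isometry_carrier[OF g]])
qed

theorem corollaryC:
  fixes l :: nat and g :: "'k::field mat"
  assumes "perfect_field TYPE('k)" and "CHAR('k) = 2"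
    and "l \<ge> 1"
    and "g \<in> orthogonal_group l"
  shows "\<exists>gs. set gs \<subseteq> elementary_matrices l \<and> g = mat_product (2 * l + 1) gs"
proof -
  have "g \<in> isometries l"
    using assms(4) by (simp add: orthogonal_group_def isometries_def)
  then have "g \<in> elementary_products l"
    using assms(1,2) by (intro isometry_elementary_product[of 0]) auto
  then show ?thesis by (rule elementary_products_mat_product)
qed

end
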